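(* Let $n\ge 1$ and let $e_1=(1,0,\dots,0),\dots,e_n=(0,\dots,0,1)$ be the standard basis of $\mathbb{Z}^n$. The elliptic group ${}_{e_1}\mathbb{Z}^n$ is a free object, in the category of elliptic groups, on the $n$-element set $\{0,e_2,\dots,e_n\}$ (that is, for every elliptic group $S$ and all $s_1,\dots,s_n\in S$ there is a unique morphism of elliptic groups $f:{}_{e_1}\mathbb{Z}^n\to S$ with $f(0)=s_1$ and $f(e_i)=s_i$ for $2\le i\le n$). In other words, for every abelian group $A$ and $a\in A$, the assignment $f\mapsto (f(0),f(e_2),\dots,f(e_n))$ induces an isomorphism of elliptic groups $$\mathrm{Hom}_{\mathrm{El}}\left({}_{e_1}\mathbb{Z}^n,\ {}_aA\right)\cong {}_{(a,\dots,a)}A^n .$$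
   Context: An elliptic group is a set $S$ (possibly empty) with a binary operation $\ast$ satisfying, for all $x,y,z,w\in S$: (EG1) $x\ast y=y\ast x$; (EG2) $x\ast(x\ast y)=y$; (EG3) $x\ast(y\ast(z\ast w))=w\ast(y\ast(z\ast x))$. A morphism of elliptic groups $f:S\to T$ is a map with $f(x\ast y)=f(x)\ast f(y)$ for all $x,y$; an isomorphism is a bijective morphism. For an (additive) abelian group $A$ and $a\in A$, ${}_aA$ denotes the elliptic group with underlying set $A$ and operation $x\ast_a y=a-x-y$. $\mathrm{Hom}_{\mathrm{El}}(S,T)$ denotes the set of morphisms of elliptic groups $S\to T$, which is an elliptic group under the pointwise operation $(f\ast g)(s)=f(s)\ast g(s)$. *)

theory Defs
  imports "HOL-Algebra.Product_Groups"
begin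

record 'a elliptic = "'a partial_object" +
  eop :: "'a \<Rightarrow> 'a \<Rightarrow> 'a" (infixl "\<star>\<index>" 70)

locale elliptic_group =
  fixes S (structure)
  assumes eop_closed: "\<lbrakk>x \<in> carrier S; y \<in> carrier S\<rbrakk> \<Longrightarrow> x \<star> y \<in> carrier S"
    and EG1: "\<lbrakk>x \<in> carrier S; y \<in> carrier S\<rbrakk> \<Longrightarrow> x \<star> y = y \<star> x"
    and EG2: "\<lbrakk>x \<in> carrier S; y \<in> carrier S\<rbrakk> \<Longrightarrow> x \<star> (x \<star> y) = y"
    and EG3: "\<lbrakk>x \<in> carrier S; y \<in> carrier S; z \<in> carrier S; w \<in> carrier S\<rbrakk>
      \<Longrightarrow> x \<star> (y \<star> (z \<star> w)) = w \<star> (y \<star> (z \<star> x))"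

text \<open>Morphisms are extensional (\<open>undefined\<close> off the carrier), so that equality of
  HOL functions is equality of maps between the carriers.\<close>

definition el_hom :: "('a, 'm) elliptic_scheme \<Rightarrow> ('b, 'k) elliptic_scheme \<Rightarrow> ('a \<Rightarrow> 'b) set" where
  "el_hom S T = {f \<in> carrier S \<rightarrow>\<^sub>E carrier T.
     \<forall>x \<in> carrier S. \<forall>y \<in> carrier S. f (x \<star>\<^bsub>S\<^esub> y) = f x \<star>\<^bsub>T\<^esub> f y}"

definition el_iso :: "('a, 'm) elliptic_scheme \<Rightarrow> ('b, 'k) elliptic_scheme \<Rightarrow> ('a \<Rightarrow> 'b) set" where
  "el_iso S T = {f \<in> el_hom S T. bij_betw f (carrier S) (carrier T)}"

definition el_Hom :: "('a, 'm) elliptic_scheme \<Rightarrow> ('b, 'k) elliptic_scheme \<Rightarrow> ('a \<Rightarrow> 'b) elliptic" where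
  "el_Hom S T = \<lparr>carrier = el_hom S T, eop = (\<lambda>f g. \<lambda>s \<in> carrier S. f s \<star>\<^bsub>T\<^esub> g s)\<rparr>"

text \<open>The elliptic group with operation \<open>a - x - y\<close>; HOL-Algebra writes abelian groups
  multiplicatively.\<close>

definition el_of_group :: "('a, 'm) monoid_scheme \<Rightarrow> 'a \<Rightarrow> 'a elliptic" where
  "el_of_group A a =
     \<lparr>carrier = carrier A, eop = (\<lambda>x y. a \<otimes>\<^bsub>A\<^esub> inv\<^bsub>A\<^esub> x \<otimes>\<^bsub>A\<^esub> inv\<^bsub>A\<^esub> y)\<rparr>"

text \<open>\<open>F\<close> is free on \<open>X \<subseteq> carrier F\<close>, tested against the elliptic groups whose elements
  have type \<open>'s\<close>. HOL cannot quantify over types inside a formula, so the type is a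
  parameter, to be left as a free type variable in theorems.\<close>

definition free_elliptic_on :: "'s itself \<Rightarrow> ('a, 'm) elliptic_scheme \<Rightarrow> 'a set \<Rightarrow> bool" where
  "free_elliptic_on _ F X \<longleftrightarrow>
     elliptic_group F \<and> X \<subseteq> carrier F \<and>
     (\<forall>S :: 's elliptic. elliptic_group S \<longrightarrow>
        (\<forall>g \<in> X \<rightarrow> carrier S. \<exists>!f. f \<in> el_hom F S \<and> (\<forall>x \<in> X. f x = g x)))"

definition power_group :: "nat \<Rightarrow> ('a, 'm) monoid_scheme \<Rightarrow> (nat \<Rightarrow> 'a) monoid" where
  "power_group n A = product_group {1..n} (\<lambda>_. A)"

abbreviation Zpow :: "nat \<Rightarrow> (nat \<Rightarrow> int) monoid" where
  "Zpow n \<equiv> power_group n integer_group"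

definition unit_vec :: "nat \<Rightarrow> nat \<Rightarrow> nat \<Rightarrow> int" where
  "unit_vec n i = (\<lambda>j \<in> {1..n}. if j = i then 1 else 0)"

text \<open>The tuple \<open>(0, e\<^sub>2, \<dots>, e\<^sub>n)\<close>, indexed by \<open>{1..n}\<close>.\<close>

definition free_gen :: "nat \<Rightarrow> nat \<Rightarrow> nat \<Rightarrow> int" where
  "free_gen n i = (if i = 1 then \<one>\<^bsub>Zpow n\<^esub> else unit_vec n i)"

lemma elliptic_group_el_of_group:
  fixes A (structure)
  assumes "comm_group A" "a \<in> carrier A"
  shows "elliptic_group (el_of_group A a)"
proof -
  interpret comm_group A by fact
  have c: "a \<otimes> inv x \<otimes> inv (a \<otimes> inv y \<otimes> inv z) = y \<otimes> z \<otimes> inv x"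
    if "x \<in> carrier A" "y \<in> carrier A" "z \<in> carrier A" for x y z
  proof -
    have "a \<otimes> inv x \<otimes> inv (a \<otimes> inv y \<otimes> inv z) = a \<otimes> inv x \<otimes> (inv a \<otimes> y \<otimes> z)"
      using that assms(2) by (simp add: inv_mult)
    also have "\<dots> = (a \<otimes> inv a) \<otimes> (y \<otimes> z \<otimes> inv x)"
      using that assms(2) by (simp only: m_ac inv_closed m_closed)
    finally show ?thesis using that assms(2) by simp
  qed
  show ?thesis
  proof (unfold_locales, goal_cases)
    case (1 x y)
    then show ?case using assms(2) by (simp add: el_of_group_def)
  next
    case (2 x y)
    then show ?case using assms(2) by (simp add: el_of_group_def m_ac)
  next
    case (3 x y)
    then have "x \<otimes> y \<otimes> inv x = y"
      by (simp add: el_of_group_def m_comm[of x y] m_assoc)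
    then show ?case using 3 c[of x x y] by (simp add: el_of_group_def)
  next
    case (4 x y z w)
    then show ?case using assms(2) by (simp add: el_of_group_def c) (simp only: inv_mult m_ac inv_closed m_closed)
  qed
qed

lemma comm_group_power_group:
  assumes "comm_group A"
  shows "comm_group (power_group n A)"
proof -
  interpret A: comm_group A by fact
  have "group (power_group n A)"
    by (simp add: power_group_def)
  then show ?thesis
    by (rule group.group_comm_groupI) (auto simp: power_group_def fun_eq_iff PiE_iff A.m_comm)
qed

lemma (in elliptic_group) medial:
  assumes "p \<in> carrier S" "q \<in> carrier S" "r \<in> carrier S" "s \<in> carrier S"
  shows "(p \<star> q) \<star> (r \<star> s) = (p \<star> r) \<star> (q \<star> s)"
proof -
  have "(p \<star> q) \<star> (s \<star> r) = (p \<star> q) \<star> (s \<star> (p \<star> (p \<star> r)))"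
    using assms by (simp add: EG2)
  also have "\<dots> = (p \<star> r) \<star> (s \<star> (p \<star> (p \<star> q)))"
    using assms by (intro EG3) (auto simp: eop_closed)
  also have "\<dots> = (p \<star> r) \<star> (s \<star> q)"
    using assms by (simp add: EG2)
  finally show ?thesis
    using assms by (simp add: EG1[of r s] EG1[of q s])
qed

lemma elliptic_group_el_Hom:
  assumes "elliptic_group S" "elliptic_group T"
  shows "elliptic_group (el_Hom S T)"
proof -
  interpret S: elliptic_group S by fact
  interpret T: elliptic_group T by fact
  have ext: "f x = undefined" if "f \<in> el_hom S T" "x \<notin> carrier S" for f x
    using that by (auto simp: el_hom_def)
  have mem: "f x \<in> carrier T" if "f \<in> el_hom S T" "x \<in> carrier S" for f x
    using that by (auto simp: el_hom_def)
  have hom: "f (x \<star>\<^bsub>S\<^esub> y) = f x \<star>\<^bsub>T\<^esub> f y"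
    if "f \<in> el_hom S T" "x \<in> carrier S" "y \<in> carrier S" for f x y
    using that by (auto simp: el_hom_def)
  have closed: "(\<lambda>s \<in> carrier S. f s \<star>\<^bsub>T\<^esub> g s) \<in> el_hom S T"
    if "f \<in> el_hom S T" "g \<in> el_hom S T" for f g
    unfolding el_hom_def[of S T]
    by (simp add: PiE_iff that mem hom S.eop_closed T.eop_closed T.medial)
  show ?thesis
  proof (unfold_locales, goal_cases)
    case (1 f g)
    then show ?case by (simp add: el_Hom_def closed)
  next
    case (2 f g)
    then show ?case by (auto simp: el_Hom_def fun_eq_iff mem T.EG1)
  next
    case (3 f g)
    then show ?case by (auto simp: el_Hom_def fun_eq_iff mem T.EG2 ext)
  next
    case (4 f g h k)
    then show ?case by (auto simp: el_Hom_def fun_eq_iff mem intro: T.EG3)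
  qed
qed

end

(*
An elliptic group S with a chosen point p becomes an abelian group with neutral element p
under x + y = p * (x * y), and its operation is recovered as x * y = p * p - x - y.
Elliptic morphisms f from (B, b - x - y) to S with f(0) = p are therefore exactly the group
homomorphisms from B to this abelian group with f(b) = p * p. For B = Z^n and b = e_1 these
correspond to free choices of the values at e_2, ..., e_n, since Z^n is free abelian and the
value at e_1 is forced by f(0).
*)
theory Submission
  imports Defs "HOL-Algebra.FiniteProduct"
begin

section \<open>The abelian group attached to a point of an elliptic group\<close>

context elliptic_group
begin

text \<open>In \<open>el_of_group A a\<close> this product is x + y - p, the group A translated so
  that p is neutral. On a smooth plane cubic, with \<open>x \<star> y\<close> the third point on the
  line through x and y, it is the usual addition with origin p.\<close>

definition pointed_group :: "'a \<Rightarrow> 'a monoid" where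
  "pointed_group p = \<lparr>carrier = carrier S, mult = (\<lambda>x y. p \<star> (x \<star> y)), one = p\<rparr>"

lemma pointed_group_simps [simp]:
  "carrier (pointed_group p) = carrier S"
  "x \<otimes>\<^bsub>pointed_group p\<^esub> y = p \<star> (x \<star> y)"
  "\<one>\<^bsub>pointed_group p\<^esub> = p"
  by (simp_all add: pointed_group_def)

text \<open>Associativity is EG3 with p in the second place, after removing the outer p. EG2 makes p
  neutral, and the inverse of x is \<open>x \<star> (p \<star> p)\<close>: multiplying it by x again
  leaves \<open>p \<star> p\<close>, which p sends back to p.\<close>

lemma comm_group_pointed_group:
  assumes p: "p \<in> carrier S"
  shows "comm_group (pointed_group p)"
proof (rule comm_groupI)
  fix x y z
  assume "x \<in> carrier (pointed_group p)" "y \<in> carrier (pointed_group p)" "z \<in> carrier (pointed_group p)"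
  then have c: "x \<in> carrier S" "y \<in> carrier S" "z \<in> carrier S"
    by simp_all
  have "z \<star> (p \<star> (x \<star> y)) = x \<star> (p \<star> (y \<star> z))"
    using EG3[of z p y x] EG1[of x y] EG1[of y z] c p by simp
  then show "x \<otimes>\<^bsub>pointed_group p\<^esub> y \<otimes>\<^bsub>pointed_group p\<^esub> z =
      x \<otimes>\<^bsub>pointed_group p\<^esub> (y \<otimes>\<^bsub>pointed_group p\<^esub> z)"
    using EG1[of "p \<star> (x \<star> y)" z] c p by (simp add: eop_closed)
next
  fix x
  assume "x \<in> carrier (pointed_group p)"
  then have x: "x \<in> carrier S"
    by simp
  have "(x \<star> (p \<star> p)) \<otimes>\<^bsub>pointed_group p\<^esub> x = \<one>\<^bsub>pointed_group p\<^esub>"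
    using x p EG1[of "x \<star> (p \<star> p)" x] by (simp add: EG2 eop_closed)
  then show "\<exists>y\<in>carrier (pointed_group p). y \<otimes>\<^bsub>pointed_group p\<^esub> x = \<one>\<^bsub>pointed_group p\<^esub>"
    using x p by (intro bexI[of _ "x \<star> (p \<star> p)"]) (simp_all add: eop_closed)
next
  fix x y
  assume "x \<in> carrier (pointed_group p)" "y \<in> carrier (pointed_group p)"
  then show "x \<otimes>\<^bsub>pointed_group p\<^esub> y = y \<otimes>\<^bsub>pointed_group p\<^esub> x"
    by (simp add: EG1[of x y])
qed (use p in \<open>simp_all add: eop_closed EG2\<close>)

text \<open>Cancelling by EG2, adding x to \<open>x \<star> y\<close> gives
  \<open>p \<star> y\<close>, and adding y to that gives \<open>p \<star> p\<close>. Solving for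
  \<open>x \<star> y\<close> yields the formula.\<close>

lemma eop_pointed_group:
  assumes "p \<in> carrier S" "x \<in> carrier S" "y \<in> carrier S"
  shows "x \<star> y = (p \<star> p) \<otimes>\<^bsub>pointed_group p\<^esub> inv\<^bsub>pointed_group p\<^esub> x
    \<otimes>\<^bsub>pointed_group p\<^esub> inv\<^bsub>pointed_group p\<^esub> y"
proof -
  let ?G = "pointed_group p"
  interpret G: comm_group ?G
    using assms by (simp add: comm_group_pointed_group)
  have x: "x \<in> carrier ?G" and y: "y \<in> carrier ?G" and xy: "x \<star> y \<in> carrier ?G"
    and pp: "p \<star> p \<in> carrier ?G"
    using assms by (simp_all add: eop_closed)
  have "(x \<star> y) \<otimes>\<^bsub>?G\<^esub> x = p \<star> y"
    using assms by (simp add: EG2 EG1[of "x \<star> y" x] eop_closed)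
  moreover have "(p \<star> y) \<otimes>\<^bsub>?G\<^esub> y = p \<star> p"
    using assms EG1[of "p \<star> y" y] EG1[of p y] by (simp add: EG2 eop_closed)
  ultimately have "(x \<star> y) \<otimes>\<^bsub>?G\<^esub> x \<otimes>\<^bsub>?G\<^esub> y = p \<star> p"
    by simp
  then show ?thesis
    by (metis G.inv_solve_right G.m_comm G.m_assoc G.m_closed pp x xy y)
qed

text \<open>This reduces elliptic morphisms to group homomorphisms. A homomorphism with
  \<open>f b = p \<star> p\<close> carries b - x - y to \<open>p \<star> p\<close> - f x - f y,
  which is \<open>f x \<star> f y\<close> by \<open>eop_pointed_group\<close>. The converse recovers
  addition in B from its elliptic operation.\<close>

lemma el_hom_pointed_group_iff:
  assumes B: "comm_group B" "b \<in> carrier B" and p: "p \<in> carrier S"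
  shows "f \<in> el_hom (el_of_group B b) S \<and> f \<one>\<^bsub>B\<^esub> = p \<longleftrightarrow>
    f \<in> hom B (pointed_group p) \<and> f \<in> extensional (carrier B) \<and> f b = p \<star> p"
proof
  interpret B: comm_group B by fact
  let ?op = "\<lambda>x y. b \<otimes>\<^bsub>B\<^esub> inv\<^bsub>B\<^esub> x \<otimes>\<^bsub>B\<^esub> inv\<^bsub>B\<^esub> y"
  let ?G = "pointed_group p"
  interpret G: comm_group ?G
    using p by (rule comm_group_pointed_group)
  {
    assume f: "f \<in> el_hom (el_of_group B b) S \<and> f \<one>\<^bsub>B\<^esub> = p"
    then have mem: "f x \<in> carrier S" if "x \<in> carrier B" for x
      using that by (auto simp: el_hom_def el_of_group_def)
    have hom: "f (?op x y) = f x \<star> f y" if "x \<in> carrier B" "y \<in> carrier B" for x y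
      using that f by (auto simp: el_hom_def el_of_group_def)
    have "f (x \<otimes>\<^bsub>B\<^esub> y) = p \<star> (f x \<star> f y)" if "x \<in> carrier B" "y \<in> carrier B" for x y
    proof -
      \<comment> \<open>Addition is expressed through the elliptic operation of B and its neutral
        element: x + y = b - 0 - (b - x - y). Since f sends 0 to p, this becomes the product of
        \<open>pointed_group p\<close>.\<close>
      have "b \<otimes>\<^bsub>B\<^esub> (inv\<^bsub>B\<^esub> b \<otimes>\<^bsub>B\<^esub> (x \<otimes>\<^bsub>B\<^esub> y)) = x \<otimes>\<^bsub>B\<^esub> y"
        using that B(2) by (simp add: B.m_assoc[symmetric])
      then have "x \<otimes>\<^bsub>B\<^esub> y = ?op \<one>\<^bsub>B\<^esub> (?op x y)"
        using that B(2) by (simp add: B.inv_mult B.m_assoc)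
      moreover have "f (?op \<one>\<^bsub>B\<^esub> (?op x y)) = p \<star> (f x \<star> f y)"
        using that f B(2) by (simp only: hom B.one_closed B.m_closed B.inv_closed)
      ultimately show ?thesis
        by simp
    qed
    \<comment> \<open>The element b is the elliptic product of 0 with itself.\<close>
    moreover have "f b = p \<star> p"
      using hom[of "\<one>\<^bsub>B\<^esub>" "\<one>\<^bsub>B\<^esub>"] f B(2) by simp
    ultimately show "f \<in> hom B ?G \<and> f \<in> extensional (carrier B) \<and> f b = p \<star> p"
      using f mem by (auto simp: hom_def el_hom_def el_of_group_def PiE_def)
  }
  {
    assume f: "f \<in> hom B ?G \<and> f \<in> extensional (carrier B) \<and> f b = p \<star> p"
    then interpret h: group_hom B ?G f
      by unfold_locales simp
    have mem: "f x \<in> carrier S" if "x \<in> carrier B" for x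
      using h.hom_closed that by simp
    have "f (?op x y) = f x \<star> f y" if "x \<in> carrier B" "y \<in> carrier B" for x y
      unfolding eop_pointed_group[OF p mem[OF that(1)] mem[OF that(2)]]
      using f that B(2) by (simp only: h.hom_mult h.hom_inv B.m_closed B.inv_closed)
    moreover have "f \<one>\<^bsub>B\<^esub> = p"
      using h.hom_one by simp
    ultimately show "f \<in> el_hom (el_of_group B b) S \<and> f \<one>\<^bsub>B\<^esub> = p"
      using f mem by (auto simp: el_hom_def el_of_group_def PiE_def)
  }
qed

end

section \<open>Z^n as a free abelian group\<close>

lemma carrier_Zpow: "carrier (Zpow n) = ({1..n} \<rightarrow>\<^sub>E UNIV)"
  by (simp add: power_group_def)

lemma unit_vec_closed [simp]: "unit_vec n i \<in> carrier (Zpow n)"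
  by (simp add: carrier_Zpow unit_vec_def)

text \<open>The map from k to k e_i is a homomorphism from the integers; composed with h, it is
  determined by its value at 1.\<close>

lemma hom_Zpow_single:
  assumes A: "comm_group A" and h: "h \<in> hom (Zpow n) A"
  shows "h (\<lambda>j\<in>{1..n}. if j = i then k else 0) = h (unit_vec n i) [^]\<^bsub>A\<^esub> (k::int)"
proof -
  let ?e = "\<lambda>k::int. \<lambda>j\<in>{1..n}. if j = i then k else 0"
  have "?e \<in> hom integer_group (Zpow n)"
    by (auto simp: hom_def carrier_Zpow power_group_def fun_eq_iff)
  then have "h \<circ> ?e \<in> hom integer_group A"
    using h by (rule Group.hom_compose)
  then interpret g: group_hom integer_group A "h \<circ> ?e"
    using A by (simp add: group_hom_def group_hom_axioms_def comm_group_def)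
  show ?thesis
    using g.hom_int_pow[of 1 k] by (simp add: unit_vec_def)
qed

lemma hom_Zpow_eq_finprod:
  assumes A: "comm_group A" and h: "h \<in> hom (Zpow n) A" and x: "x \<in> carrier (Zpow n)"
  shows "h x = finprod A (\<lambda>i. h (unit_vec n i) [^]\<^bsub>A\<^esub> x i) {1..n}"
proof -
  interpret A: comm_group A by fact
  interpret h: group_hom "Zpow n" A h
    using h A.group_axioms comm_group_power_group[OF abelian_integer_group, of n]
    by (simp add: group_hom_def group_hom_axioms_def comm_group_def)
  have e: "h (unit_vec n i) \<in> carrier A" for i
    by simp
  \<comment> \<open>\<open>?r I\<close> keeps the coordinates of x in I and clears the others, so x
    is built up one coordinate at a time. Indices outside \<open>{1..n}\<close> are harmless: their
    \<open>unit_vec\<close> is zero, and h sends it to the neutral element.\<close>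
  let ?r = "\<lambda>I. \<lambda>j\<in>{1..n}. if j \<in> I then x j else 0"
  have "h (?r I) = finprod A (\<lambda>i. h (unit_vec n i) [^]\<^bsub>A\<^esub> x i) I" if "finite I" for I
    using that
  proof (induction I)
    case empty
    have "?r {} = \<one>\<^bsub>Zpow n\<^esub>"
      by (simp add: power_group_def)
    then show ?case
      by simp
  next
    case (insert i I)
    have "?r (insert i I) = (\<lambda>j\<in>{1..n}. if j = i then x i else 0) \<otimes>\<^bsub>Zpow n\<^esub> ?r I"
      using insert.hyps by (auto simp: power_group_def fun_eq_iff)
    moreover have "(\<lambda>j\<in>{1..n}. if j = i then x i else 0) \<in> carrier (Zpow n)" "?r I \<in> carrier (Zpow n)"
      by (simp_all add: carrier_Zpow)
    ultimately show ?case
      using insert.hyps hom_Zpow_single[OF A h, of i "x i"] e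
      by (simp only: h.hom_mult insert.IH) simp
  qed
  moreover have "?r {1..n} = x"
    using x by (auto simp: carrier_Zpow fun_eq_iff)
  ultimately show ?thesis
    by (metis finite_atLeastAtMost)
qed

text \<open>Written multiplicatively, the extension of t sends x to the product of the powers of
  \<open>t i\<close> with exponents \<open>x i\<close>. By \<open>hom_Zpow_eq_finprod\<close> every
  homomorphism has this form, which gives uniqueness.\<close>

lemma Zpow_free_abelian:
  assumes A: "comm_group A" and t: "t \<in> {1..n} \<rightarrow> carrier A"
  shows "\<exists>!f. f \<in> hom (Zpow n) A \<and> f \<in> extensional (carrier (Zpow n)) \<and>
    (\<forall>i\<in>{1..n}. f (unit_vec n i) = t i)"
proof -
  interpret A: comm_group A by fact
  define F where "F = (\<lambda>x\<in>carrier (Zpow n). finprod A (\<lambda>i. t i [^]\<^bsub>A\<^esub> (x i :: int)) {1..n})"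
  have Z: "x \<otimes>\<^bsub>Zpow n\<^esub> y \<in> carrier (Zpow n)"
    if "x \<in> carrier (Zpow n)" "y \<in> carrier (Zpow n)" for x y
    using that by (auto simp: power_group_def)
  have c: "(\<lambda>i. t i [^]\<^bsub>A\<^esub> (x i :: int)) \<in> {1..n} \<rightarrow> carrier A" for x
    using t by auto
  have "F (x \<otimes>\<^bsub>Zpow n\<^esub> y) = F x \<otimes>\<^bsub>A\<^esub> F y"
    if "x \<in> carrier (Zpow n)" "y \<in> carrier (Zpow n)" for x y
  proof -
    have "finprod A (\<lambda>i. t i [^]\<^bsub>A\<^esub> (x \<otimes>\<^bsub>Zpow n\<^esub> y) i) {1..n} =
        finprod A (\<lambda>i. t i [^]\<^bsub>A\<^esub> x i \<otimes>\<^bsub>A\<^esub> t i [^]\<^bsub>A\<^esub> y i) {1..n}"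
      using t by (intro A.finprod_cong') (auto simp: power_group_def A.int_pow_mult Pi_iff)
    then show ?thesis
      using Z that c by (simp add: F_def)
  qed
  then have hom: "F \<in> hom (Zpow n) A"
    using c by (auto simp: hom_def F_def)
  have unit: "F (unit_vec n i) = t i" if "i \<in> {1..n}" for i
  proof -
    have "finprod A (\<lambda>j. t j [^]\<^bsub>A\<^esub> unit_vec n i j) {1..n} =
        finprod A (\<lambda>j. if i = j then t j else \<one>\<^bsub>A\<^esub>) {1..n}"
      using t by (intro A.finprod_cong') (auto simp: unit_vec_def Pi_iff)
    also have "\<dots> = t i"
      using that t by (intro A.finprod_singleton) auto
    finally show ?thesis
      by (simp add: F_def)
  qed
  have "f = g"
    if f: "f \<in> hom (Zpow n) A \<and> f \<in> extensional (carrier (Zpow n)) \<and> (\<forall>i\<in>{1..n}. f (unit_vec n i) = t i)"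
      and g: "g \<in> hom (Zpow n) A \<and> g \<in> extensional (carrier (Zpow n)) \<and> (\<forall>i\<in>{1..n}. g (unit_vec n i) = t i)"
    for f g
  proof (rule extensionalityI[of _ "carrier (Zpow n)"])
    fix x
    assume x: "x \<in> carrier (Zpow n)"
    have "finprod A (\<lambda>i. f (unit_vec n i) [^]\<^bsub>A\<^esub> x i) {1..n} = finprod A (\<lambda>i. g (unit_vec n i) [^]\<^bsub>A\<^esub> x i) {1..n}"
      using f g c[of x] by (intro A.finprod_cong') (auto simp: Pi_iff)
    then show "f x = g x"
      using hom_Zpow_eq_finprod[OF A] f g x by metis
  qed (use f g in auto)
  moreover have "F \<in> extensional (carrier (Zpow n))"
    by (simp add: F_def)
  ultimately show ?thesis
    using hom unit by blast
qed

section \<open>Freeness of the elliptic group on Z^n\<close>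

lemma el_hom_Zpow_ex1:
  assumes S: "elliptic_group S" and n: "n \<ge> 1" and s: "\<forall>i \<in> {1..n}. s i \<in> carrier S"
  shows "\<exists>!f. f \<in> el_hom (el_of_group (Zpow n) (unit_vec n 1)) S
    \<and> f \<one>\<^bsub>Zpow n\<^esub> = s 1 \<and> (\<forall>i \<in> {2..n}. f (unit_vec n i) = s i)"
proof -
  interpret elliptic_group S by fact
  have Z: "comm_group (Zpow n)"
    by (intro comm_group_power_group abelian_integer_group)
  have s1: "s 1 \<in> carrier S"
    using n s by simp
  \<comment> \<open>In the group pointed at \<open>s 1\<close>, every homomorphism already sends 0
    to \<open>s 1\<close>. The remaining condition for an elliptic morphism prescribes the value at
    e_1, so the first entry of the tuple is replaced by that value.\<close>
  let ?t = "s(1 := s 1 \<star>\<^bsub>S\<^esub> s 1)"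
  have "{1..n} = insert 1 {2..n}"
    using n by auto
  then have "(\<forall>i\<in>{1..n}. f (unit_vec n i) = ?t i) \<longleftrightarrow>
      f (unit_vec n 1) = s 1 \<star>\<^bsub>S\<^esub> s 1 \<and> (\<forall>i\<in>{2..n}. f (unit_vec n i) = s i)" for f
    by auto
  moreover have "\<exists>!f. f \<in> hom (Zpow n) (pointed_group (s 1)) \<and> f \<in> extensional (carrier (Zpow n)) \<and>
      (\<forall>i\<in>{1..n}. f (unit_vec n i) = ?t i)"
    using s s1 by (intro Zpow_free_abelian comm_group_pointed_group) (auto simp: eop_closed)
  ultimately have "\<exists>!f. (f \<in> hom (Zpow n) (pointed_group (s 1)) \<and> f \<in> extensional (carrier (Zpow n)) \<and>
      f (unit_vec n 1) = s 1 \<star>\<^bsub>S\<^esub> s 1) \<and> (\<forall>i\<in>{2..n}. f (unit_vec n i) = s i)"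
    by (simp only: conj_assoc)
  then show ?thesis
    by (simp only: el_hom_pointed_group_iff[OF Z unit_vec_closed s1, symmetric] conj_assoc)
qed

lemma free_gen_eq_iff:
  assumes "n \<ge> 1"
  shows "(\<forall>i\<in>{1..n}. f (free_gen n i) = s i) \<longleftrightarrow>
    f \<one>\<^bsub>Zpow n\<^esub> = s 1 \<and> (\<forall>i \<in> {2..n}. f (unit_vec n i) = s i)"
proof -
  have "{1..n} = insert 1 {2..n}"
    using assms by auto
  then show ?thesis
    by (auto simp: free_gen_def)
qed

lemma free_gen_image:
  assumes "n \<ge> 1"
  shows "free_gen n ` {1..n} = insert \<one>\<^bsub>Zpow n\<^esub> (unit_vec n ` {2..n})"
proof -
  have "{1..n} = insert 1 {2..n}"
    using assms by auto
  then show ?thesis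
    by (auto simp: free_gen_def intro!: image_cong)
qed

lemma free_gen_closed: "free_gen n i \<in> carrier (Zpow n)"
  by (auto simp: free_gen_def power_group_def unit_vec_def)

lemma inj_on_free_gen: "inj_on (free_gen n) {1..n}"
proof (rule inj_onI)
  fix i j
  assume ij: "i \<in> {1..n}" "j \<in> {1..n}" and eq: "free_gen n i = free_gen n j"
  have "free_gen n k l = (if k = l \<and> k \<noteq> 1 then 1 else 0)" if "k \<in> {1..n}" "l \<in> {1..n}" for k l
    using that by (auto simp: free_gen_def power_group_def unit_vec_def)
  \<comment> \<open>If i and j differ, at least one of them is not 1; its generator has entry 1 at
    its own index, where the other generator vanishes.\<close>
  then show "i = j"
    using ij fun_cong[OF eq, of i] fun_cong[OF eq, of j] by (auto split: if_splits)
qed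

lemma free_elliptic_on_Zpow:
  assumes n: "n \<ge> 1"
  shows "free_elliptic_on TYPE('s) (el_of_group (Zpow n) (unit_vec n 1)) (free_gen n ` {1..n})"
  unfolding free_elliptic_on_def
proof (intro conjI allI impI ballI)
  show "elliptic_group (el_of_group (Zpow n) (unit_vec n 1))"
    by (intro elliptic_group_el_of_group comm_group_power_group abelian_integer_group unit_vec_closed)
  show "free_gen n ` {1..n} \<subseteq> carrier (el_of_group (Zpow n) (unit_vec n 1))"
    by (auto simp: el_of_group_def free_gen_closed)
  fix S :: "'s elliptic" and g
  assume S: "elliptic_group S" and g: "g \<in> free_gen n ` {1..n} \<rightarrow> carrier S"
  \<comment> \<open>A map g on the generating set is read as the tuple of its values at the
    \<open>free_gen n i\<close>, to which \<open>el_hom_Zpow_ex1\<close> applies.\<close>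
  have "\<forall>i\<in>{1..n}. g (free_gen n i) \<in> carrier S"
    using g by auto
  from el_hom_Zpow_ex1[OF S n this]
  show "\<exists>!f. f \<in> el_hom (el_of_group (Zpow n) (unit_vec n 1)) S \<and> (\<forall>x\<in>free_gen n ` {1..n}. f x = g x)"
    unfolding ball_simps free_gen_eq_iff[OF n, where s = "\<lambda>i. g (free_gen n i)"] .
qed

section \<open>Evaluation at the generators\<close>

text \<open>Evaluation respects the operations because both are pointwise. Bijectivity is the free
  property for the target \<open>el_of_group A a\<close>: existence of extensions gives
  surjectivity, uniqueness gives injectivity.\<close>

lemma el_iso_eval_free_gen:
  assumes n: "n \<ge> 1" and A: "comm_group A" and a: "a \<in> carrier A"
  shows "(\<lambda>f \<in> el_hom (el_of_group (Zpow n) (unit_vec n 1)) (el_of_group A a).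
      \<lambda>i \<in> {1..n}. f (free_gen n i))
    \<in> el_iso (el_Hom (el_of_group (Zpow n) (unit_vec n 1)) (el_of_group A a))
      (el_of_group (power_group n A) (\<lambda>i \<in> {1..n}. a))"
    (is "?ev \<in> el_iso (el_Hom ?F ?T) ?P")
proof -
  note One_nat_def [simp del]
  interpret A: comm_group A by fact
  have cF: "carrier ?F = carrier (Zpow n)" and cT: "carrier ?T = carrier A"
    and cH: "carrier (el_Hom ?F ?T) = el_hom ?F ?T" and cP: "carrier ?P = ({1..n} \<rightarrow>\<^sub>E carrier A)"
    by (simp_all add: el_of_group_def el_Hom_def power_group_def)
  have T: "elliptic_group ?T"
    using A a by (rule elliptic_group_el_of_group)
  have F: "elliptic_group ?F"
    by (intro elliptic_group_el_of_group comm_group_power_group abelian_integer_group unit_vec_closed)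
  \<comment> \<open>The evaluation map is defined by restriction to \<open>el_hom\<close>, so it can
    be unfolded at a pointwise product only once that product is known to be a morphism.\<close>
  have closed: "f \<star>\<^bsub>el_Hom ?F ?T\<^esub> g \<in> el_hom ?F ?T" if "f \<in> el_hom ?F ?T" "g \<in> el_hom ?F ?T" for f g
    using elliptic_group.eop_closed[OF elliptic_group_el_Hom[OF F T]] that cH by simp
  have mem: "f (free_gen n i) \<in> carrier A" if "f \<in> el_hom ?F ?T" for f i
    using that free_gen_closed[of n i] cF cT by (auto simp: el_hom_def)
  have ev_mem: "?ev f \<in> carrier ?P" if "f \<in> el_hom ?F ?T" for f
    using that by (simp add: cP mem)
  have "?ev (f \<star>\<^bsub>el_Hom ?F ?T\<^esub> g) = ?ev f \<star>\<^bsub>?P\<^esub> ?ev g"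
    if f: "f \<in> el_hom ?F ?T" and g: "g \<in> el_hom ?F ?T" for f g
  proof -
    have "?ev (f \<star>\<^bsub>el_Hom ?F ?T\<^esub> g) = (\<lambda>i\<in>{1..n}. (f \<star>\<^bsub>el_Hom ?F ?T\<^esub> g) (free_gen n i))"
      using closed[OF f g] by simp
    also have "\<dots> = (\<lambda>i\<in>{1..n}. f (free_gen n i) \<star>\<^bsub>?T\<^esub> g (free_gen n i))"
      by (simp add: el_Hom_def cF free_gen_closed)
    also have "\<dots> = ?ev f \<star>\<^bsub>?P\<^esub> ?ev g"
      using f g by (simp add: el_of_group_def power_group_def mem fun_eq_iff PiE_iff)
    finally show ?thesis .
  qed
  then have "?ev \<in> el_hom (el_Hom ?F ?T) ?P"
    using ev_mem by (auto simp: el_hom_def[of "el_Hom ?F ?T"] cH)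
  moreover have "bij_betw ?ev (el_hom ?F ?T) (carrier ?P)"
    unfolding bij_betw_def
  proof (intro conjI equalityI subsetI)
    have ex1: "\<exists>!f. f \<in> el_hom ?F ?T \<and> (\<forall>i\<in>{1..n}. f (free_gen n i) = s i)"
      if "\<forall>i\<in>{1..n}. s i \<in> carrier A" for s
      using el_hom_Zpow_ex1[OF T n] that unfolding free_gen_eq_iff[OF n] cT by blast
    show "inj_on ?ev (el_hom ?F ?T)"
    proof (rule inj_onI)
      fix f g
      assume fg: "f \<in> el_hom ?F ?T" "g \<in> el_hom ?F ?T" "?ev f = ?ev g"
      then have "\<forall>i\<in>{1..n}. f (free_gen n i) = g (free_gen n i)"
        by (auto simp: fun_eq_iff split: if_splits)
      then show "f = g"
        using ex1[of "\<lambda>i. g (free_gen n i)"] fg mem by blast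
    qed
    show "s \<in> ?ev ` el_hom ?F ?T" if s: "s \<in> carrier ?P" for s
    proof -
      from s obtain f where "f \<in> el_hom ?F ?T" "\<forall>i\<in>{1..n}. f (free_gen n i) = s i"
        using ex1[of s] cP by auto
      \<comment> \<open>Both tuples are \<open>undefined\<close> outside \<open>{1..n}\<close>, so
        agreement on the indices makes them equal as functions.\<close>
      moreover from this s have "?ev f = s"
        by (auto simp: cP fun_eq_iff)
      ultimately show ?thesis
        by blast
    qed
  qed (use ev_mem in auto)
  ultimately show ?thesis
    by (simp add: el_iso_def cH)
qed

theorem theorem8p1:
  fixes n :: nat
  assumes "n \<ge> 1"
  shows
    "card (insert \<one>\<^bsub>Zpow n\<^esub> (unit_vec n ` {2..n})) = n
     \<and> free_elliptic_on TYPE('s) (el_of_group (Zpow n) (unit_vec n 1))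
         (insert \<one>\<^bsub>Zpow n\<^esub> (unit_vec n ` {2..n}))
     \<and> (\<forall>(S :: 's elliptic) s. elliptic_group S \<and> (\<forall>i \<in> {1..n}. s i \<in> carrier S) \<longrightarrow>
         (\<exists>!f. f \<in> el_hom (el_of_group (Zpow n) (unit_vec n 1)) S
             \<and> f \<one>\<^bsub>Zpow n\<^esub> = s 1 \<and> (\<forall>i \<in> {2..n}. f (unit_vec n i) = s i)))
     \<and> (\<forall>(A :: ('b, 'm) monoid_scheme) a. comm_group A \<and> a \<in> carrier A \<longrightarrow>
         (\<lambda>f \<in> el_hom (el_of_group (Zpow n) (unit_vec n 1)) (el_of_group A a).
            \<lambda>i \<in> {1..n}. f (free_gen n i))
         \<in> el_iso (el_Hom (el_of_group (Zpow n) (unit_vec n 1)) (el_of_group A a))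
                   (el_of_group (power_group n A) (\<lambda>i \<in> {1..n}. a)))"
proof (intro conjI allI impI)
  show "card (insert \<one>\<^bsub>Zpow n\<^esub> (unit_vec n ` {2..n})) = n"
    \<comment> \<open>The generating set is the injective image of \<open>{1..n}\<close>, so 0, e_2,
      ..., e_n are n distinct elements.\<close>
    using card_image[OF inj_on_free_gen[of n]] by (simp only: free_gen_image[OF assms]) simp
  show "free_elliptic_on TYPE('s) (el_of_group (Zpow n) (unit_vec n 1))
      (insert \<one>\<^bsub>Zpow n\<^esub> (unit_vec n ` {2..n}))"
    using free_elliptic_on_Zpow[OF assms] by (simp only: free_gen_image[OF assms])
  fix S :: "'s elliptic" and s
  assume "elliptic_group S \<and> (\<forall>i \<in> {1..n}. s i \<in> carrier S)"
  then show "\<exists>!f. f \<in> el_hom (el_of_group (Zpow n) (unit_vec n 1)) S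
      \<and> f \<one>\<^bsub>Zpow n\<^esub> = s 1 \<and> (\<forall>i \<in> {2..n}. f (unit_vec n i) = s i)"
    by (elim conjE) (rule el_hom_Zpow_ex1[OF _ assms])
next
  fix A :: "('b, 'm) monoid_scheme" and a
  assume "comm_group A \<and> a \<in> carrier A"
  then show "(\<lambda>f \<in> el_hom (el_of_group (Zpow n) (unit_vec n 1)) (el_of_group A a).
      \<lambda>i \<in> {1..n}. f (free_gen n i))
      \<in> el_iso (el_Hom (el_of_group (Zpow n) (unit_vec n 1)) (el_of_group A a))
        (el_of_group (power_group n A) (\<lambda>i \<in> {1..n}. a))"
    by (elim conjE) (rule el_iso_eval_free_gen[OF assms])
qed

end
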